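(* Let $(C,Z,\models)$ and $(C',Z,\models')$ be concept-class triples with the same observation set $Z$ such that $C\subseteq C'$ and, for all $c\in C$ and $z\in Z$, $c\models z$ if and only if $c\models' z$. Let $L$ be a MAP-learner for $(C',Z,\models')$ with parameters $P(c')>0$ and $P(z|c')$ ($c'\in C'$, $z\in Z$). Set $P(C)=\sum_{c\in C}P(c)$ and let $L_{\downarrow C}$ be the MAP-learner for $(C,Z,\models)$ with priors $P(c)/P(C)$ and conditional likelihoods $P(z|c)$ for $c\in C$, $z\in Z$. Then for each sampling mode $(\alpha,\beta)\in\{O,\overline{O}\}\times\{R,\overline{R}\}$, $$\mathrm{MAP\text{-}TD}^{\alpha,\beta}_{L_{\downarrow C}}(C,Z,\models)\ \le\ \mathrm{MAP\text{-}TD}^{\alpha,\beta}_{L}(C',Z,\models').$$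
   Context: A concept-class triple $(C,Z,\models)$ consists of a finite set $C$ with $|C|\ge 2$ (the concept class), a non-empty finite set $Z$ (the observations) and a relation $\models$ on $C\times Z$ (consistency). Sampling modes are pairs $(\alpha,\beta)\in\{O,\overline{O}\}\times\{R,\overline{R}\}$ (ordered/unordered, with/without replacement). $\mathcal{Z}^{O,R}$ is the set of finite sequences over $Z$; $\mathcal{Z}^{\overline{O},R}$ the set of finite multisets over $Z$; $\mathcal{Z}^{O,\overline{R}}$ the set of repetition-free sequences over $Z$; $\mathcal{Z}^{\overline{O},\overline{R}}=2^Z$. The empty sequence/multiset/set is included and denoted $\emptyset$; $|I|$ is the length of a sequence or the cardinality (with multiplicity) of a (multi)set. For a probability vector $Q=(q(z))_{z\in Z}$: $P^{O,R}((z_1,\dots,z_n)|Q)=\prod_{i=1}^n q(z_i)$; for a multiset $A$ of size $n$ with distinct elements $z'_1,\dots,z'_k$ of multiplicities $n_1,\dots,n_k$, $P^{\overline{O},R}(A|Q)=\frac{n!}{n_1!\cdots n_k!}\prod_{i=1}^k q(z'_i)^{n_i}$; for a repetition-free sequence with $n\le|\{z:q(z)>0\}|$, $P^{O,\overline{R}}((z_1,\dots,z_n)|Q)=\prod_{i=1}^n \frac{q(z_i)}{1-(q(z_1)+\dots+q(z_{i-1}))}$; for a set $A=\{z_1,\dots,z_n\}$ of size $n\le|\{z:q(z)>0\}|$, $P^{\overline{O},\overline{R}}(A|Q)=\sum_\sigma P^{O,\overline{R}}((z_{\sigma(1)},\dots,z_{\sigma(n)})|Q)$ over all permutations $\sigma$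 of $\{1,\dots,n\}$. The probability of $\emptyset$ is $1$ in every mode. A MAP-learner $L$ for $(C,Z,\models)$ is given by priors $P(c)>0$ with $\sum_{c\in C}P(c)=1$ and conditional likelihoods $P(z|c)\ge 0$ with $\sum_{z\in Z}P(z|c)=1$ for each $c\in C$, subject to the validity condition: $c\not\models z$ implies $P(z|c)=0$. Write $P^{\alpha,\beta}(I|c)$ for $P^{\alpha,\beta}(I|P(\cdot|c))$ and $N^+(C,L)=\min_{c\in C}|\{z\in Z:P(z|c)>0\}|$. A teacher for $L$ in mode $(\alpha,\beta)$ is a map $T:C\to\mathcal{Z}^{\alpha,\beta}$ such that for every $c_0\in C$: if $\beta=\overline{R}$ then $|T(c_0)|\le N^+(C,L)$; and $c_0$ is the unique maximizer over $c\in C$ of $P(c)\cdot P^{\alpha,\beta}(T(c_0)|c)$. The order of $T$ is $\max_{c\in C}|T(c)|$. $\mathrm{MAP\text{-}TD}^{\alpha,\beta}_L(C,Z,\models)$ is the smallest order of a teacher for $L$ in mode $(\alpha,\beta)$, or $\infty$ if no teacher exists. *)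

theory Defs
  imports Complex_Main "HOL-Library.Extended_Nat" "HOL-Combinatorics.Multiset_Permutations"
begin

text \<open>\<open>(c, z) \<in> R\<close> means that concept \<open>c\<close> is consistent with observation \<open>z\<close>.\<close>

definition concept_triple :: "'c set \<Rightarrow> 'z set \<Rightarrow> ('c \<times> 'z) set \<Rightarrow> bool" where
  "concept_triple C Z R \<longleftrightarrow>
     finite C \<and> card C \<ge> 2 \<and> finite Z \<and> Z \<noteq> {} \<and> R \<subseteq> C \<times> Z"

datatype sampling_order = Ordered | Unordered
datatype replacement = With_Replacement | Without_Replacement

datatype 'z sample = Seq "'z list" | Multi "'z multiset" | Subset "'z set"

fun sample_size :: "'z sample \<Rightarrow> nat" where
  "sample_size (Seq zs) = length zs"
| "sample_size (Multi M) = size M"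
| "sample_size (Subset A) = card A"

fun samples :: "sampling_order \<Rightarrow> replacement \<Rightarrow> 'z set \<Rightarrow> 'z sample set" where
  "samples Ordered With_Replacement Z = {Seq zs |zs. set zs \<subseteq> Z}"
| "samples Unordered With_Replacement Z = {Multi M |M. set_mset M \<subseteq> Z}"
| "samples Ordered Without_Replacement Z = {Seq zs |zs. set zs \<subseteq> Z \<and> distinct zs}"
| "samples Unordered Without_Replacement Z = {Subset A |A. A \<subseteq> Z}"

definition prob_seq_without_replacement :: "('z \<Rightarrow> real) \<Rightarrow> 'z list \<Rightarrow> real" where
  "prob_seq_without_replacement q zs =
     (\<Prod>i<length zs. q (zs ! i) / (1 - (\<Sum>j<i. q (zs ! j))))"

text \<open>
  The equations below cover exactly the combinations of mode and kind of sample that are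
  compatible with \<^const>\<open>samples\<close>; the value is unspecified on the others. Without
  replacement, the formulas are meaningful only for samples no larger than the support of
  \<open>q\<close>: then no denominator vanishes. Teachers are required to respect this bound.
  Summing over \<open>permutations_of_set A\<close> means summing over all repetition-free enumerations
  of \<open>A\<close>.
\<close>

fun sample_prob :: "sampling_order \<Rightarrow> replacement \<Rightarrow> ('z \<Rightarrow> real) \<Rightarrow> 'z sample \<Rightarrow> real" where
  "sample_prob Ordered With_Replacement q (Seq zs) = (\<Prod>i<length zs. q (zs ! i))"
| "sample_prob Unordered With_Replacement q (Multi M) =
     fact (size M) / (\<Prod>z\<in>set_mset M. fact (count M z)) * (\<Prod>z\<in>set_mset M. q z ^ count M z)"
| "sample_prob Ordered Without_Replacement q (Seq zs) = prob_seq_without_replacement q zs"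
| "sample_prob Unordered Without_Replacement q (Subset A) =
     (\<Sum>zs\<in>permutations_of_set A. prob_seq_without_replacement q zs)"

text \<open>\<open>likelihood L c z\<close> is the conditional likelihood \<open>P(z|c)\<close>.\<close>

record ('c, 'z) learner =
  prior :: "'c \<Rightarrow> real"
  likelihood :: "'c \<Rightarrow> 'z \<Rightarrow> real"

definition MAP_learner :: "'c set \<Rightarrow> 'z set \<Rightarrow> ('c \<times> 'z) set \<Rightarrow> ('c, 'z) learner \<Rightarrow> bool" where
  "MAP_learner C Z R L \<longleftrightarrow>
     (\<forall>c\<in>C. prior L c > 0) \<and> (\<Sum>c\<in>C. prior L c) = 1 \<and>
     (\<forall>c\<in>C. (\<forall>z\<in>Z. likelihood L c z \<ge> 0) \<and> (\<Sum>z\<in>Z. likelihood L c z) = 1) \<and>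
     (\<forall>c\<in>C. \<forall>z\<in>Z. (c, z) \<notin> R \<longrightarrow> likelihood L c z = 0)"

definition restrict_learner :: "'c set \<Rightarrow> ('c, 'z) learner \<Rightarrow> ('c, 'z) learner" where
  "restrict_learner C L =
     \<lparr>prior = (\<lambda>c. prior L c / (\<Sum>d\<in>C. prior L d)), likelihood = likelihood L\<rparr>"

definition N_plus :: "'c set \<Rightarrow> 'z set \<Rightarrow> ('c, 'z) learner \<Rightarrow> nat" where
  "N_plus C Z L = Min ((\<lambda>c. card {z\<in>Z. likelihood L c z > 0}) ` C)"

text \<open>
  The consistency relation constrains the learner through \<^const>\<open>MAP_learner\<close>; it does not
  occur in the notion of a teacher. Only the values of \<open>T\<close> on \<open>C\<close> matter.
\<close>

definition teacher ::
  "sampling_order \<Rightarrow> replacement \<Rightarrow> 'c set \<Rightarrow> 'z set \<Rightarrow> ('c, 'z) learner \<Rightarrow> ('c \<Rightarrow> 'z sample) \<Rightarrow> bool"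
where
  "teacher \<alpha> \<beta> C Z L T \<longleftrightarrow>
     (\<forall>c\<^sub>0\<in>C. T c\<^sub>0 \<in> samples \<alpha> \<beta> Z \<and>
        (\<beta> = Without_Replacement \<longrightarrow> sample_size (T c\<^sub>0) \<le> N_plus C Z L) \<and>
        (\<forall>c. is_arg_max (\<lambda>c. prior L c * sample_prob \<alpha> \<beta> (likelihood L c) (T c\<^sub>0)) (\<lambda>c. c \<in> C) c
             \<longleftrightarrow> c = c\<^sub>0))"

definition teacher_order :: "'c set \<Rightarrow> ('c \<Rightarrow> 'z sample) \<Rightarrow> nat" where
  "teacher_order C T = Max ((\<lambda>c. sample_size (T c)) ` C)"

text \<open>In \<^typ>\<open>enat\<close>, the infimum of a non-empty set is its least element, and \<open>Inf {} = \<infinity>\<close>.\<close>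

definition MAP_TD ::
  "sampling_order \<Rightarrow> replacement \<Rightarrow> 'c set \<Rightarrow> 'z set \<Rightarrow> ('c, 'z) learner \<Rightarrow> enat"
where
  "MAP_TD \<alpha> \<beta> C Z L = Inf {enat (teacher_order C T) |T. teacher \<alpha> \<beta> C Z L T}"

lemma MAP_learner_restrict_learner:
  assumes "concept_triple C Z R" "concept_triple C' Z R'" "C \<subseteq> C'"
    and "\<And>c z. c \<in> C \<Longrightarrow> z \<in> Z \<Longrightarrow> (c, z) \<in> R \<longleftrightarrow> (c, z) \<in> R'"
    and "MAP_learner C' Z R' L"
  shows "MAP_learner C Z R (restrict_learner C L)"
proof -
  have "C \<noteq> {}" "finite C"
    using assms(1) by (auto simp: concept_triple_def)
  then have pos: "(\<Sum>d\<in>C. prior L d) > 0"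
    using assms(3,5) by (intro sum_pos) (auto simp: MAP_learner_def)
  then have "(\<Sum>c\<in>C. prior L c / (\<Sum>d\<in>C. prior L d)) = 1"
    by (simp flip: sum_divide_distrib)
  with pos show ?thesis
    using assms(3-5) by (auto simp: MAP_learner_def restrict_learner_def subset_iff)
qed

end

theory Submission
  imports Defs
begin

text \<open>
  The restriction to \<open>C\<close> of a teacher for \<open>L\<close> is a teacher for the restricted learner:
  renormalising the priors scales every posterior score by the same positive factor, a unique
  maximiser remains the unique maximiser on a subset containing it, and both the minimum
  \<open>N\<^sup>+\<close> (which can only grow) and the maximum defining the order (which can only shrink) are
  taken over a smaller set.
\<close>

lemma is_arg_max_divide_pos:
  fixes f :: "'a \<Rightarrow> 'b::linordered_field"
  assumes "s > 0"
  shows "is_arg_max (\<lambda>x. f x / s) P = is_arg_max f P"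
  using assms by (auto simp: is_arg_max_def fun_eq_iff divide_less_cancel)

text \<open>Since \<open>a\<close> lies in \<open>A\<close>, any maximiser over \<open>A\<close>
  scores at least \<open>f a\<close>, which is already the maximum over \<open>B\<close>. It is
  therefore a maximiser over \<open>B\<close> too, and uniqueness there applies.\<close>

lemma unique_arg_max_subset:
  fixes f :: "'a \<Rightarrow> 'b::linorder"
  assumes "\<And>x. is_arg_max f (\<lambda>x. x \<in> B) x \<longleftrightarrow> x = a" "A \<subseteq> B" "a \<in> A"
  shows "is_arg_max f (\<lambda>x. x \<in> A) x \<longleftrightarrow> x = a"
proof
  assume x: "is_arg_max f (\<lambda>x. x \<in> A) x"
  then have "f a \<le> f x" "x \<in> B"
    using assms(2,3) by (auto simp: is_arg_max_linorder)
  moreover have "\<forall>y\<in>B. f y \<le> f a"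
    using assms(1)[of a] by (auto simp: is_arg_max_linorder)
  ultimately have "is_arg_max f (\<lambda>x. x \<in> B) x"
    by (auto simp: is_arg_max_linorder intro: order_trans)
  then show "x = a"
    using assms(1) by blast
next
  assume "x = a"
  then show "is_arg_max f (\<lambda>x. x \<in> A) x"
    using assms(1)[of a] assms(2,3) by (auto simp: is_arg_max_linorder)
qed

text \<open>Restriction keeps the likelihoods, so both sides are minima of the same support sizes,
  the right one over fewer concepts.\<close>

lemma N_plus_restrict_learner_ge:
  assumes "finite C'" "C \<subseteq> C'" "C \<noteq> {}"
  shows "N_plus C' Z L \<le> N_plus C Z (restrict_learner C L)"
  unfolding N_plus_def restrict_learner_def using assms by (auto intro!: Min_antimono)

lemma teacher_restrict_learner:
  assumes T: "teacher \<alpha> \<beta> C' Z L T"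
    and C: "finite C'" "C \<subseteq> C'" "C \<noteq> {}"
    and pos: "\<And>c. c \<in> C \<Longrightarrow> prior L c > 0"
  shows "teacher \<alpha> \<beta> C Z (restrict_learner C L) T"
  unfolding teacher_def
proof (intro ballI conjI impI allI)
  fix c\<^sub>0 c
  assume c\<^sub>0: "c\<^sub>0 \<in> C"
  then have "c\<^sub>0 \<in> C'"
    using C by blast
  note T' = T[unfolded teacher_def, rule_format, OF this]
  show "T c\<^sub>0 \<in> samples \<alpha> \<beta> Z"
    using T' by blast
  show "sample_size (T c\<^sub>0) \<le> N_plus C Z (restrict_learner C L)" if "\<beta> = Without_Replacement"
    using T' that N_plus_restrict_learner_ge[OF C] order_trans by blast
  have "(\<Sum>d\<in>C. prior L d) > 0"
    using C pos by (intro sum_pos) (auto intro: finite_subset)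
  moreover have "is_arg_max (\<lambda>c. prior L c * sample_prob \<alpha> \<beta> (likelihood L c) (T c\<^sub>0)) (\<lambda>c. c \<in> C) c
      \<longleftrightarrow> c = c\<^sub>0"
    by (rule unique_arg_max_subset[OF _ C(2) c\<^sub>0]) (use T' in blast)
  ultimately show "is_arg_max (\<lambda>c. prior (restrict_learner C L) c *
          sample_prob \<alpha> \<beta> (likelihood (restrict_learner C L) c) (T c\<^sub>0)) (\<lambda>c. c \<in> C) c
        \<longleftrightarrow> c = c\<^sub>0"
    \<comment> \<open>Simplification moves the normalising sum out of the prior, so that it divides
      the whole score.\<close>
    by (simp add: restrict_learner_def is_arg_max_divide_pos)
qed

lemma teacher_order_mono:
  assumes "finite C'" "C \<subseteq> C'" "C \<noteq> {}"
  shows "teacher_order C T \<le> teacher_order C' T"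
  unfolding teacher_order_def using assms by (auto intro!: Max_mono)

theorem lemma3p5:
  fixes C C' :: "'c set" and Z :: "'z set" and R R' :: "('c \<times> 'z) set"
    and L :: "('c, 'z) learner" and \<alpha> :: sampling_order and \<beta> :: replacement
  assumes "concept_triple C Z R"
    and "concept_triple C' Z R'"
    and "C \<subseteq> C'"
    and "\<forall>c\<in>C. \<forall>z\<in>Z. (c, z) \<in> R \<longleftrightarrow> (c, z) \<in> R'"
    and "MAP_learner C' Z R' L"
  shows "MAP_TD \<alpha> \<beta> C Z (restrict_learner C L) \<le> MAP_TD \<alpha> \<beta> C' Z L"
proof -
  have C: "finite C'" "C \<subseteq> C'" "C \<noteq> {}"
    using assms(1-3) by (auto simp: concept_triple_def)
  have "teacher \<alpha> \<beta> C Z (restrict_learner C L) T" if "teacher \<alpha> \<beta> C' Z L T" for T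
    using that C assms(5) by (intro teacher_restrict_learner) (auto simp: MAP_learner_def)
  then show ?thesis
    unfolding MAP_TD_def
    \<comment> \<open>Each order on the right is matched by that of the same \<open>T\<close> on the
      left; with no teacher for \<open>L\<close> the right side is infinite.\<close>
    by (intro Inf_mono) (use teacher_order_mono[OF C] enat_ord_simps(1) in blast)
qed

end
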